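(* Let $X$ and $Y$ be patterned matrices with link functions $L_1$ and $L_2$. (i) Suppose both link functions satisfy Property B, and all input variables (of both matrices) are independent real random variables with mean $0$, variance $1$ and, for every $m$, uniformly bounded $m$-th absolute moments. Consider any monomial in $X$ and $Y$ of length $2k$. Then $$|\Pi_C^*(w)|\ge n^{1+k}\quad\text{for any colored Catalan word } w \text{ corresponding to the monomial.}$$ As a consequence, $p_C(w)\ge 1$ for any colored Catalan word $w$ (whenever the limit $p_C(w)$ exists). (ii) Suppose the link functions satisfy Property B and Property P, and all input variables (of both matrices) are independent real random variables with mean $0$, variance $1$ and, for every $m$, uniformly bounded $m$-th absolute moments. Then for any colored Catalan word $w$, $p_C(w)=1$.
   Context: A patterned matrix with (symmetric) link function $L:\{1,\dots,n\}^2\to\mathbb Z^d$ ($d=1$ or $2$; dependence on $n$ suppressed) and input sequence $\{x(t)\}$ of real random variables is the $n\times n$ real symmetric matrix with $(i,j)$ entry $x(L(i,j))$. Property B for $L$: $\sup_n\sup_t\sup_{1\le k\le n}\#\{l:1\le l\le n,\ L(k,l)=t\}<\infty$. Property P for $L$: $\sup_n\sup_{i\ne j}\#\{1\le k\le n: L(k,i)=L(k,j)\}<\infty$. For a monomial $q=Z_{c_1}\cdots Z_{c_{2k}}$ with colors $c_i\in\{1,2\}$, $Z_1=X$, $Z_2=Y$, $CW(2)$ is the set of colored pair-matched words corresponding to $q$: words $w=w[1]\cdots w[2k]$ (up to renaming of letters) in which each letter appears exactly twice and $w[i]=w[j]$ implies $c_i=c_j$. A word $w\in CW(2)$ is a colored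 Catalan word if sequentially deleting all double letters (adjacent equal letters, of the same color) leads to the empty word. A circuit is a map $\pi:\{0,1,\dots,2k\}\to\{1,\dots,n\}$ with $\pi(0)=\pi(2k)$, $$\Pi_C^*(w)=\{\pi \text{ circuit}: w[i]=w[j]\Rightarrow c_i=c_j \text{ and } L_{c_i}(\pi(i-1),\pi(i))=L_{c_j}(\pi(j-1),\pi(j))\},$$ and $p_C(w)=\lim_{n\to\infty}n^{-(1+k)}|\Pi_C^*(w)|$. *)

theory Defs
  imports "HOL-Probability.Probability"
begin

text \<open>The argument order is \<open>L n i j\<close>: the first argument is the dimension of the matrix,
  and only the values with \<open>i, j \<in> {1..n}\<close> are meaningful.\<close>

type_synonym 'd link = "nat \<Rightarrow> nat \<Rightarrow> nat \<Rightarrow> int ^ 'd"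

definition link_function :: "'d::finite link \<Rightarrow> bool" where
  "link_function L \<longleftrightarrow>
     CARD('d) \<in> {1, 2} \<and> (\<forall>n. \<forall>i\<in>{1..n}. \<forall>j\<in>{1..n}. L n i j = L n j i)"

definition property_B :: "'d::finite link \<Rightarrow> bool" where
  "property_B L \<longleftrightarrow>
     (\<exists>C::nat. \<forall>n t. \<forall>k\<in>{1..n}. card {l \<in> {1..n}. L n k l = t} \<le> C)"

definition property_P :: "'d::finite link \<Rightarrow> bool" where
  "property_P L \<longleftrightarrow>
     (\<exists>C::nat. \<forall>n. \<forall>i\<in>{1..n}. \<forall>j\<in>{1..n}. i \<noteq> j \<longrightarrow>
        card {k \<in> {1..n}. L n k i = L n k j} \<le> C)"

text \<open>A sequence \<open>X\<close> of random matrices: \<open>X n i j\<close> is the \<open>(i, j)\<close> entry of the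
  \<open>n \<times> n\<close> matrix, a function on the sample space.\<close>

definition patterned_matrix ::
  "'d::finite link \<Rightarrow> (int ^ 'd \<Rightarrow> 'a \<Rightarrow> real) \<Rightarrow> (nat \<Rightarrow> nat \<Rightarrow> nat \<Rightarrow> 'a \<Rightarrow> real) \<Rightarrow> bool" where
  "patterned_matrix L x X \<longleftrightarrow>
     link_function L \<and> (\<forall>n. \<forall>i\<in>{1..n}. \<forall>j\<in>{1..n}. X n i j = x (L n i j))"

definition (in prob_space) standard_inputs :: "('t \<Rightarrow> 'a \<Rightarrow> real) \<Rightarrow> bool" where
  "standard_inputs z \<longleftrightarrow>
     indep_vars (\<lambda>_. borel) z UNIV \<and>
     (\<forall>t. expectation (z t) = 0 \<and> variance (z t) = 1) \<and>
     (\<forall>m::nat. \<exists>C. \<forall>t. integrable M (\<lambda>\<omega>. \<bar>z t \<omega>\<bar> ^ m) \<and>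
                       expectation (\<lambda>\<omega>. \<bar>z t \<omega>\<bar> ^ m) \<le> C)"

text \<open>The colors 1 (for \<open>X\<close>) and 2 (for \<open>Y\<close>). A monomial is the list of its colors.\<close>

datatype color = Color_X | Color_Y

text \<open>The two link functions may take values in \<open>\<int>\<^sup>d\<close> for different \<open>d\<close>, so the
  value of \<open>L\<^sub>c\<close> is injected into the disjoint sum. Between equal colors, equality in the sum
  is equality of the link values.\<close>

definition color_link ::
  "'d1::finite link \<Rightarrow> 'd2::finite link \<Rightarrow> color \<Rightarrow> nat \<Rightarrow> nat \<Rightarrow> nat \<Rightarrow> int ^ 'd1 + int ^ 'd2" where
  "color_link L1 L2 c n i j =
     (case c of Color_X \<Rightarrow> Inl (L1 n i j) | Color_Y \<Rightarrow> Inr (L2 n i j))"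

text \<open>Words are represented by lists over an arbitrary type of letters, without passing to the
  quotient by renaming; nothing below depends on the names of the letters.\<close>

definition CW2 :: "color list \<Rightarrow> 'l list set" where
  "CW2 cs = {w. length w = length cs \<and>
               (\<forall>a\<in>set w. count_list w a = 2) \<and>
               (\<forall>i<length w. \<forall>j<length w. w ! i = w ! j \<longrightarrow> cs ! i = cs ! j)}"

text \<open>Deletion acts on words whose letters carry their color, so that \<open>[a, a]\<close> below is a double
  letter of one color.\<close>

inductive delete_double :: "('l \<times> color) list \<Rightarrow> ('l \<times> color) list \<Rightarrow> bool" where
  "delete_double (u @ [a, a] @ v) (u @ v)"

definition colored_catalan :: "color list \<Rightarrow> 'l list \<Rightarrow> bool" where
  "colored_catalan cs w \<longleftrightarrow> w \<in> CW2 cs \<and> delete_double\<^sup>*\<^sup>* (zip w cs) []"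

definition circuits :: "nat \<Rightarrow> nat \<Rightarrow> (nat \<Rightarrow> nat) set" where
  "circuits k n = {\<pi> \<in> {0..2*k} \<rightarrow>\<^sub>E {1..n}. \<pi> 0 = \<pi> (2*k)}"

text \<open>Positions in words are counted from 1, hence the shift in the list accesses.\<close>

definition Pi_C ::
  "'d1::finite link \<Rightarrow> 'd2::finite link \<Rightarrow> color list \<Rightarrow> nat \<Rightarrow> 'l list \<Rightarrow> nat \<Rightarrow> (nat \<Rightarrow> nat) set" where
  "Pi_C L1 L2 cs k w n =
     {\<pi> \<in> circuits k n. \<forall>i\<in>{1..2*k}. \<forall>j\<in>{1..2*k}. w ! (i - 1) = w ! (j - 1) \<longrightarrow>
        cs ! (i - 1) = cs ! (j - 1) \<and>
        color_link L1 L2 (cs ! (i - 1)) n (\<pi> (i - 1)) (\<pi> i) =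
        color_link L1 L2 (cs ! (j - 1)) n (\<pi> (j - 1)) (\<pi> j)}"

definition p_C_seq ::
  "'d1::finite link \<Rightarrow> 'd2::finite link \<Rightarrow> color list \<Rightarrow> nat \<Rightarrow> 'l list \<Rightarrow> nat \<Rightarrow> real" where
  "p_C_seq L1 L2 cs k w n = real (card (Pi_C L1 L2 cs k w n)) / real n ^ (1 + k)"

text \<open>Only meaningful when \<open>p_C_seq L1 L2 cs k w\<close> is convergent.\<close>

definition p_C ::
  "'d1::finite link \<Rightarrow> 'd2::finite link \<Rightarrow> color list \<Rightarrow> nat \<Rightarrow> 'l list \<Rightarrow> real" where
  "p_C L1 L2 cs k w = lim (p_C_seq L1 L2 cs k w)"

end

theory Submission
  imports Defs
begin

text \<open>Circuits are closed walks, written as vertex lists. Reinsert a double letter \<open>aa\<close> into a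
  Catalan word at a vertex \<open>x\<close>: by symmetry of the link, every spike \<open>x, j, x\<close> satisfies the
  constraint of \<open>a\<close>, which gives \<open>n\<close> new circuits for each old one and hence the lower bound.
  The other circuits pass through \<open>x, j, y\<close> with \<open>x \<noteq> y\<close>. Property P leaves boundedly many \<open>j\<close>,
  and by Property B the remaining open walk along \<open>k - 1\<close> letters has \<open>O(n\<^sup>k)\<close> choices,
  so these circuits do not contribute to the limit.\<close>

section \<open>Walks as vertex lists\<close>

text \<open>Positions are forgotten deliberately: the constraints on a circuit only compare steps
  with the same letter, so cutting, rotating and inserting become operations on sets of
  triples.\<close>

definition steps :: "'e list \<Rightarrow> 'v list \<Rightarrow> ('e \<times> 'v \<times> 'v) set" where
  "steps z p = set (zip z (zip p (tl p)))"

lemma steps_Nil [simp]: "steps [] p = {}"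
  by (simp add: steps_def)

lemma steps_Cons [simp]: "steps (s # z) (x # y # p) = insert (s, x, y) (steps z (y # p))"
  by (simp add: steps_def)

text \<open>The cut vertex \<open>x\<close> is shared: it ends the walk along \<open>u\<close> and
  starts the walk along \<open>v\<close>.\<close>

lemma steps_append:
  "length p = length u \<Longrightarrow> steps (u @ v) (p @ x # q) = steps u (p @ [x]) \<union> steps v (x # q)"
proof (induction u arbitrary: p)
  case (Cons s u)
  then obtain y p' where p: "p = y # p'" "length p' = length u"
    by (cases p) auto
  show ?case
    using Cons.IH[OF p(2)] p by (cases p') auto
qed simp

lemma letter_of_step: "(s, x, y) \<in> steps z p \<Longrightarrow> s \<in> set z"
  unfolding steps_def by (rule set_zip_leftD)

lemma step_of_letter:
  assumes "s \<in> set z" and "length p = Suc (length z)"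
  obtains x y where "(s, x, y) \<in> steps z p"
proof -
  have "fst ` steps z p = set z"
    using assms(2) unfolding steps_def by (simp flip: set_map)
  then show ?thesis
    using assms(1) that by force
qed

lemma steps_conv_nth:
  "length p = Suc (length z) \<Longrightarrow> steps z p = {(z ! i, p ! i, p ! Suc i) |i. i < length z}"
  unfolding steps_def set_zip by (auto simp: nth_tl)

section \<open>Pair-matched words\<close>

definition pair_matched :: "'e list \<Rightarrow> bool" where
  "pair_matched z \<longleftrightarrow> (\<forall>s\<in>set z. count_list z s = 2)"

lemma length_pair_matched: "pair_matched z \<Longrightarrow> length z = 2 * card (set z)"
  using sum_count_set[of z "set z"] by (simp add: pair_matched_def)

text \<open>The double letter uses up both occurrences of \<open>a\<close>, so \<open>a\<close> is
  absent from the rest and the other counts are unchanged.\<close>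

lemma pair_matched_delete:
  assumes "pair_matched (u @ [a, a] @ v)"
  shows "pair_matched (u @ v)" and "a \<notin> set u" and "a \<notin> set v"
proof -
  have "count_list u a + count_list v a = 0"
    using assms by (auto simp: pair_matched_def)
  then show "a \<notin> set u" "a \<notin> set v"
    by (auto simp: count_list_0_iff)
  then show "pair_matched (u @ v)"
    using assms unfolding pair_matched_def by (auto split: if_splits)
qed

section \<open>Counting walks constrained by symmetric links\<close>

text \<open>In the application \<open>V\<close> is \<open>{1..n}\<close>, a letter \<open>s\<close>
  carries its color, and \<open>G s\<close> is the link function of that color. This hides the
  colors from the counting.\<close>

locale symmetric_links =
  fixes V :: "'v set" and G :: "'e \<Rightarrow> 'v \<Rightarrow> 'v \<Rightarrow> 'b"
  assumes finite_V: "finite V"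
    and G_sym: "\<And>s x y. x \<in> V \<Longrightarrow> y \<in> V \<Longrightarrow> G s x y = G s y x"
begin

definition consistent :: "('e \<times> 'v \<times> 'v) set \<Rightarrow> bool" where
  "consistent E \<longleftrightarrow>
     (\<forall>s x y x' y'. (s, x, y) \<in> E \<longrightarrow> (s, x', y') \<in> E \<longrightarrow> G s x y = G s x' y')"

definition walks :: "'e list \<Rightarrow> 'v list set" where
  "walks z = {p. length p = Suc (length z) \<and> set p \<subseteq> V \<and> consistent (steps z p)}"

definition closed_walks :: "'e list \<Rightarrow> 'v list set" where
  "closed_walks z = {p \<in> walks z. hd p = last p}"

lemma consistentD:
  "consistent E \<Longrightarrow> (s, x, y) \<in> E \<Longrightarrow> (s, x', y') \<in> E \<Longrightarrow> G s x y = G s x' y'"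
  unfolding consistent_def by blast

lemma consistent_Collect:
  "consistent {(f i, g i, h i) |i. i < N} \<longleftrightarrow>
    (\<forall>i<N. \<forall>j<N. f i = f j \<longrightarrow> G (f i) (g i) (h i) = G (f j) (g j) (h j))"
  for N :: nat
proof (intro iffI allI impI)
  fix i j
  assume con: "consistent {(f i, g i, h i) |i. i < N}" and "i < N" "j < N" "f i = f j"
  then have "(f i, g i, h i) \<in> {(f i, g i, h i) |i. i < N}" "(f i, g j, h j) \<in> {(f i, g i, h i) |i. i < N}"
    by blast+
  then have "G (f i) (g i) (h i) = G (f i) (g j) (h j)"
    by (rule consistentD[OF con])
  then show "G (f i) (g i) (h i) = G (f j) (g j) (h j)"
    using \<open>f i = f j\<close> by simp
qed (auto simp only: consistent_def mem_Collect_eq prod.inject)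

lemma consistent_subset: "consistent E \<Longrightarrow> F \<subseteq> E \<Longrightarrow> consistent F"
  unfolding consistent_def by blast

lemma finite_walks: "finite (walks z)"
  by (rule finite_subset[OF _ finite_lists_length_eq[OF finite_V, of "Suc (length z)"]])
    (auto simp: walks_def)

lemma finite_closed_walks: "finite (closed_walks z)"
  using finite_walks by (simp add: closed_walks_def)

lemma walks_Nil: "walks [] = (\<lambda>x. [x]) ` V"
  by (auto simp: walks_def consistent_def length_Suc_conv)

lemma card_closed_walks_Nil: "card (closed_walks []) = card V"
proof -
  have "closed_walks [] = (\<lambda>x. [x]) ` V"
    by (auto simp: closed_walks_def walks_Nil)
  then show ?thesis
    by (simp add: card_image inj_on_def)
qed

text \<open>The first occurrence of a letter leaves the next vertex free, every later one
  leaves at most \<open>B\<close> choices.\<close>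

lemma card_walks_le:
  assumes B: "\<And>s x t. x \<in> V \<Longrightarrow> card {y \<in> V. G s x y = t} \<le> B" and "1 \<le> B"
  shows "card (walks z) \<le> card V ^ Suc (card (set z)) * B ^ length z"
proof (induction z rule: rev_induct)
  case Nil
  show ?case
    using card_image_le[OF finite_V, of "\<lambda>x. [x]"] by (simp add: walks_Nil)
next
  case (snoc s z)
  \<comment> \<open>These are the admissible last vertices. For a letter new to \<open>z\<close> the
    condition is void and leaves all of \<open>V\<close>.\<close>
  define next_vertices where
    "next_vertices q =
       {y \<in> V. s \<in> set z \<longrightarrow> (\<forall>x' y'. (s, x', y') \<in> steps z q \<longrightarrow> G s (last q) y = G s x' y')}" for q
  define m where "m = (if s \<in> set z then B else card V)"
  have sub: "walks (z @ [s]) \<subseteq> (\<lambda>(q, y). q @ [y]) ` (SIGMA q:walks z. next_vertices q)"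
  proof
    fix p assume p: "p \<in> walks (z @ [s])"
    then have "length p = Suc (Suc (length z))"
      by (simp add: walks_def)
    then obtain r x y where peq: "p = r @ [x, y]" and r: "length r = length z"
      by (metis append_Cons append_Nil append_assoc length_Suc_conv_rev)
    have st: "steps (z @ [s]) p = insert (s, x, y) (steps z (r @ [x]))"
      using steps_append[of r z "[s]" x "[y]"] r peq by simp
    have "r @ [x] \<in> walks z"
      using p st peq by (auto simp: walks_def intro: consistent_subset)
    moreover have "consistent (insert (s, x, y) (steps z (r @ [x])))" and "y \<in> V"
      using p st peq by (auto simp: walks_def)
    then have "y \<in> next_vertices (r @ [x])"
      unfolding next_vertices_def by (auto intro!: consistentD)
    ultimately show "p \<in> (\<lambda>(q, y). q @ [y]) ` (SIGMA q:walks z. next_vertices q)"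
      using peq by (auto intro!: image_eqI[where x = "(r @ [x], y)"])
  qed
  have fin: "finite (next_vertices q)" for q
    using finite_V by (simp add: next_vertices_def)
  have "card (next_vertices q) \<le> m" if q: "q \<in> walks z" for q
  proof (cases "s \<in> set z")
    case True
    \<comment> \<open>One earlier step labelled \<open>s\<close> fixes the value of the link, so
      Property B applies at the vertex \<open>last q\<close>.\<close>
    obtain x' y' where "(s, x', y') \<in> steps z q"
      using q True by (auto simp: walks_def elim: step_of_letter)
    then have "next_vertices q \<subseteq> {y \<in> V. G s (last q) y = G s x' y'}"
      using True by (auto simp: next_vertices_def)
    then have "card (next_vertices q) \<le> card {y \<in> V. G s (last q) y = G s x' y'}"
      using finite_V by (intro card_mono) auto
    moreover have "q \<noteq> []" "set q \<subseteq> V"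
      using q by (auto simp: walks_def)
    then have "last q \<in> V"
      using last_in_set by blast
    ultimately show ?thesis
      using B le_trans True by (fastforce simp: m_def)
  next
    case False
    then show ?thesis
      using finite_V by (auto simp: m_def next_vertices_def)
  qed
  then have "(\<Sum>q\<in>walks z. card (next_vertices q)) \<le> card (walks z) * m"
    using sum_bounded_above[of "walks z" "\<lambda>q. card (next_vertices q)" m] by simp
  then have "card (walks (z @ [s])) \<le> card (walks z) * m"
    using surj_card_le[OF _ sub] finite_walks fin by (simp add: card_SigmaI finite_SigmaI)
  also have "\<dots> \<le> card V ^ Suc (card (set z)) * B ^ length z * m"
    using snoc.IH by (rule mult_right_mono) simp
  \<comment> \<open>An old letter contributes exactly the factor \<open>B\<close>; a new one
    contributes \<open>card V\<close>, and \<open>1 \<le> B\<close> pays for the additional factor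
    \<open>B\<close>.\<close>
  also have "\<dots> \<le> card V ^ Suc (card (set (z @ [s]))) * B ^ length (z @ [s])"
    using \<open>1 \<le> B\<close> by (auto simp: m_def insert_absorb)
  finally show ?case .
qed

section \<open>Inserting and deleting a double letter\<close>

text \<open>By freshness the only steps labelled \<open>a\<close> are the two of the spike, which
  agree by symmetry; all other comparisons take place inside \<open>E\<close>.\<close>

lemma consistent_double:
  assumes "consistent E" and "G a x j = G a j x" and fresh: "\<And>x' y'. (a, x', y') \<notin> E"
  shows "consistent ({(a, x, j), (a, j, x)} \<union> E)"
  unfolding consistent_def
proof (intro allI impI)
  fix s x1 y1 x2 y2
  assume 1: "(s, x1, y1) \<in> {(a, x, j), (a, j, x)} \<union> E" and 2: "(s, x2, y2) \<in> {(a, x, j), (a, j, x)} \<union> E"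
  show "G s x1 y1 = G s x2 y2"
  proof (cases "s = a")
    case True
    then have "G s x1 y1 = G a x j" "G s x2 y2 = G a x j"
      using 1 2 assms(2) fresh by fastforce+
    then show ?thesis by simp
  next
    case False
    then show ?thesis
      using 1 2 by (intro consistentD[OF assms(1)]) auto
  qed
qed

text \<open>Cutting out a spike only removes steps, and consistency passes to subsets.\<close>

lemma closed_walk_insertD:
  assumes "p1 @ x # j # x # p2 \<in> closed_walks (u @ [a, a] @ v)"
    and "length p1 = length u"
  shows "p1 @ x # p2 \<in> closed_walks (u @ v)"
proof -
  have "steps (u @ v) (p1 @ x # p2) \<subseteq> steps (u @ [a, a] @ v) (p1 @ x # j # x # p2)"
    using assms(2) by (auto simp: steps_append)
  then show ?thesis
    \<comment> \<open>If \<open>p1\<close> is empty, \<open>x\<close> itself is the base point of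
      the circuit.\<close>
    using assms by (cases p1) (auto simp: closed_walks_def walks_def intro: consistent_subset split: if_splits)
qed

text \<open>The tip \<open>j\<close> is arbitrary in \<open>V\<close>; this is the source of the
  factor \<open>n\<close> gained with each letter.\<close>

lemma closed_walk_insertI:
  assumes "p1 @ x # p2 \<in> closed_walks (u @ v)" and "length p1 = length u" and "j \<in> V"
    and "a \<notin> set u" and "a \<notin> set v"
  shows "p1 @ x # j # x # p2 \<in> closed_walks (u @ [a, a] @ v)"
proof -
  have V: "set (p1 @ x # p2) \<subseteq> V" and con: "consistent (steps (u @ v) (p1 @ x # p2))"
    using assms(1) by (auto simp: closed_walks_def walks_def)
  have st: "steps (u @ [a, a] @ v) (p1 @ x # j # x # p2) =
      {(a, x, j), (a, j, x)} \<union> steps (u @ v) (p1 @ x # p2)"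
    using assms(2) by (auto simp: steps_append)
  have "G a x j = G a j x"
    using V assms(3) by (intro G_sym) auto
  moreover have "(a, x', y') \<notin> steps (u @ v) (p1 @ x # p2)" for x' y'
    using letter_of_step[of a x' y' "u @ v"] assms(4,5) by auto
  ultimately have "consistent (steps (u @ [a, a] @ v) (p1 @ x # j # x # p2))"
    using con unfolding st by (intro consistent_double)
  then show ?thesis
    using assms by (cases p1) (auto simp: closed_walks_def walks_def split: if_splits)
qed

text \<open>Since \<open>drop m p\<close> begins with \<open>p ! m\<close>, that vertex ends up on
  both sides of \<open>j\<close>.\<close>

definition insert_spike :: "nat \<Rightarrow> 'v list \<times> 'v \<Rightarrow> 'v list" where
  "insert_spike m = (\<lambda>(p, j). take m p @ p ! m # j # drop m p)"

lemma insert_spike_append [simp]: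
  "length p1 = m \<Longrightarrow> insert_spike m (p1 @ x # p2, j) = p1 @ x # j # x # p2"
  by (simp add: insert_spike_def nth_append)

text \<open>The spike sits at the fixed position \<open>length u\<close>, so the old circuit and
  \<open>j\<close> can be read off the new circuit: insertion is injective.\<close>

lemma card_closed_walks_insert_ge:
  assumes "a \<notin> set u" and "a \<notin> set v"
  shows "card (closed_walks (u @ v)) * card V \<le> card (closed_walks (u @ [a, a] @ v))"
proof -
  have split: "\<exists>p1 x p2. p = p1 @ x # p2 \<and> length p1 = length u"
    if "p \<in> closed_walks (u @ v)" for p
    using that id_take_nth_drop[of "length u" p]
    by (intro exI[of _ "take (length u) p"]) (auto simp: closed_walks_def walks_def)
  let ?f = "insert_spike (length u)"
  have "?f ` (closed_walks (u @ v) \<times> V) \<subseteq> closed_walks (u @ [a, a] @ v)"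
    using closed_walk_insertI[OF _ _ _ assms] split by fastforce
  moreover have "inj_on ?f (closed_walks (u @ v) \<times> V)"
  proof (rule inj_onI, clarify)
    fix p j p' j'
    assume "p \<in> closed_walks (u @ v)" "p' \<in> closed_walks (u @ v)" and eq: "?f (p, j) = ?f (p', j')"
    then obtain p1 x p2 p1' x' p2' where
      "p = p1 @ x # p2" "length p1 = length u" "p' = p1' @ x' # p2'" "length p1' = length u"
      using split by metis
    then show "p = p' \<and> j = j'"
      using eq by simp
  qed
  ultimately have "card (closed_walks (u @ v) \<times> V) \<le> card (closed_walks (u @ [a, a] @ v))"
    using finite_closed_walks card_inj_on_le by blast
  then show ?thesis
    by (simp add: card_cartesian_product)
qed

text \<open>If the two vertices \<open>x\<close>, \<open>y\<close> around the deleted double letter differ, rotating the rest of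
  the circuit turns it into a walk from \<open>y\<close> to \<open>x\<close> along \<open>v @ u\<close>.\<close>

lemma rotate_closed_walk:
  assumes p: "p1 @ x # j # y # p2 \<in> closed_walks (u @ [a, a] @ v)" and p1: "length p1 = length u"
    and "x \<noteq> y"
  obtains q where "q \<in> walks (v @ u)" and "j \<in> {j \<in> V. hd q \<noteq> last q \<and> G a j (hd q) = G a j (last q)}"
    and "p1 @ x # j # y # p2 = drop (length v) q @ j # take (Suc (length v)) q"
proof -
  have p2: "length p2 = length v"
    using p p1 by (simp add: closed_walks_def walks_def)
  \<comment> \<open>\<open>c\<close> is the base point of the circuit: it ends the arc starting at
    \<open>y\<close> and, by closedness, begins the arc leading to \<open>x\<close>.\<close>
  define c where "c = last (y # p2)"
  obtain r where r: "y # p2 = r @ [c]"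
    unfolding c_def by (metis append_butlast_last_id list.distinct(1))
  obtain r' where r': "p1 @ [x] = c # r'"
    using p unfolding c_def by (cases p1) (auto simp: closed_walks_def split: if_splits)
  have lr: "length r = length v" and lr': "length r' = length u"
    using arg_cong[OF r, of length] arg_cong[OF r', of length] p1 p2 by simp_all
  \<comment> \<open>The arcs are glued at \<open>c\<close>: along \<open>v\<close> from
    \<open>y\<close> to \<open>c\<close>, then along \<open>u\<close> from \<open>c\<close> to
    \<open>x\<close>.\<close>
  define q where "q = r @ c # r'"
  have hq: "hd q = y"
    using r by (cases r) (auto simp: q_def)
  have lq: "last q = x"
    using arg_cong[OF r', of last] by (simp add: q_def)
  have st: "steps (u @ [a, a] @ v) (p1 @ x # j # y # p2) =
      {(a, x, j), (a, j, y)} \<union> steps u (p1 @ [x]) \<union> steps v (y # p2)"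
    using p1 by (auto simp: steps_append)
  have "steps (v @ u) q = steps v (y # p2) \<union> steps u (p1 @ [x])"
    unfolding q_def r r' using lr by (rule steps_append)
  moreover have "set q \<subseteq> set (p1 @ [x]) \<union> set (y # p2)"
    unfolding q_def r r' by auto
  ultimately have "q \<in> walks (v @ u)"
    using p lr lr' st by (auto simp: closed_walks_def walks_def q_def intro: consistent_subset)
  moreover have V: "j \<in> V" "x \<in> V"
      and con: "consistent ({(a, x, j), (a, j, y)} \<union> steps u (p1 @ [x]) \<union> steps v (y # p2))"
    using p st by (auto simp: closed_walks_def walks_def)
  \<comment> \<open>Both steps at \<open>j\<close> carry the letter \<open>a\<close>; symmetry then
    gives the equation that Property P bounds.\<close>
  have "G a x j = G a j y"
    using con by (rule consistentD) auto
  then have "j \<in> {j \<in> V. hd q \<noteq> last q \<and> G a j (hd q) = G a j (last q)}"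
    using hq lq \<open>x \<noteq> y\<close> V G_sym[of x j a] by simp
  moreover have "p1 @ x # j # y # p2 = (p1 @ [x]) @ j # (y # p2)"
    by simp
  \<comment> \<open>Cutting \<open>q\<close> at \<open>c\<close>, which sits at index
    \<open>length v\<close>, and swapping the arcs recovers the circuit from \<open>q\<close> and
    \<open>j\<close>.\<close>
  then have "p1 @ x # j # y # p2 = drop (length v) q @ j # take (Suc (length v)) q"
    unfolding r r' using lr by (simp add: q_def)
  ultimately show ?thesis
    by (rule that)
qed

text \<open>The first summand accounts for spikes. Every other circuit is recovered from its rotated
  open walk and one of at most \<open>C\<close> vertices \<open>j\<close>.\<close>

lemma card_closed_walks_insert_le:
  assumes C: "\<And>s x y. x \<in> V \<Longrightarrow> y \<in> V \<Longrightarrow> x \<noteq> y \<Longrightarrow> card {j \<in> V. G s j x = G s j y} \<le> C"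
  shows "card (closed_walks (u @ [a, a] @ v)) \<le>
    card (closed_walks (u @ v)) * card V + card (walks (v @ u)) * C"
proof -
  \<comment> \<open>With \<open>hd q \<noteq> last q\<close> built in, \<open>J q\<close> is empty
    for closed \<open>q\<close>, so the bound \<open>C\<close> holds for every walk.\<close>
  define J where "J q = {j \<in> V. hd q \<noteq> last q \<and> G a j (hd q) = G a j (last q)}" for q
  let ?S = "closed_walks (u @ v) \<times> V" and ?R = "SIGMA q:walks (v @ u). J q"
  let ?f = "insert_spike (length u)"
    and ?g = "\<lambda>(q, j). drop (length v) q @ j # take (Suc (length v)) q"
  have sub: "closed_walks (u @ [a, a] @ v) \<subseteq> ?f ` ?S \<union> ?g ` ?R"
  proof
    fix p assume p: "p \<in> closed_walks (u @ [a, a] @ v)"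
    then have len: "length p = length u + 3 + length v"
      by (simp add: closed_walks_def walks_def)
    define p1 where "p1 = take (length u) p"
    have "length (drop (length u) p) = Suc (Suc (Suc (length v)))"
      using len by simp
    then obtain x j y p2 where "drop (length u) p = x # j # y # p2"
      unfolding length_Suc_conv by blast
    then have peq: "p = p1 @ x # j # y # p2" and p1: "length p1 = length u"
      using append_take_drop_id[of "length u" p] len by (simp_all add: p1_def)
    show "p \<in> ?f ` ?S \<union> ?g ` ?R"
    proof (cases "x = y")
      case True
      then have "p1 @ x # p2 \<in> closed_walks (u @ v)"
        using closed_walk_insertD p p1 peq by blast
      moreover have "j \<in> V"
        using p peq by (auto simp: closed_walks_def walks_def)
      ultimately have "?f (p1 @ x # p2, j) \<in> ?f ` ?S"
        by blast
      then show ?thesis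
        using p1 peq True by simp
    next
      case False
      then obtain q where "q \<in> walks (v @ u)" "j \<in> J q"
        "p = drop (length v) q @ j # take (Suc (length v)) q"
        using rotate_closed_walk[OF p[unfolded peq] p1] unfolding peq J_def by blast
      then show ?thesis
        by (auto intro!: image_eqI[where x = "(q, j)"])
    qed
  qed
  have finJ: "finite (J q)" for q
    using finite_V by (simp add: J_def)
  have J_le: "card (J q) \<le> C" if q: "q \<in> walks (v @ u)" for q
  proof (cases "hd q = last q")
    case False
    have "q \<noteq> []" "set q \<subseteq> V"
      using q by (auto simp: walks_def)
    then have "hd q \<in> V" "last q \<in> V"
      using hd_in_set last_in_set by blast+
    then show ?thesis
      using C False by (simp add: J_def)
  qed (simp add: J_def)
  have finS: "finite ?S" and finR: "finite ?R"
    using finite_V finite_walks finite_closed_walks finJ by auto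
  have "card (closed_walks (u @ [a, a] @ v)) \<le> card (?f ` ?S \<union> ?g ` ?R)"
    using finS finR by (intro card_mono[OF _ sub]) blast
  also have "\<dots> \<le> card (?f ` ?S) + card (?g ` ?R)"
    by (rule card_Un_le)
  also have "\<dots> \<le> card ?S + card ?R"
    using finS finR by (intro add_mono card_image_le)
  also have "card ?S = card (closed_walks (u @ v)) * card V"
    by (rule card_cartesian_product)
  also have "card ?R \<le> card (walks (v @ u)) * C"
    using finite_walks finJ J_le sum_bounded_above[of "walks (v @ u)" "\<lambda>q. card (J q)" C]
    by (simp add: card_SigmaI)
  finally show ?thesis
    by simp
qed

end

section \<open>Bounds for Catalan words\<close>

text \<open>The deletions are read backwards, from the empty word up; pair-matching makes every
  inserted letter fresh.\<close>

lemma reducible_pair_matched_induct [consumes 2, case_names Nil insert]: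
  assumes "delete_double\<^sup>*\<^sup>* z []" and "pair_matched z"
    and "P []"
    and "\<And>u v a. pair_matched (u @ v) \<Longrightarrow> a \<notin> set u \<Longrightarrow> a \<notin> set v \<Longrightarrow> P (u @ v) \<Longrightarrow> P (u @ [a, a] @ v)"
  shows "P z"
  using assms(1,2)
proof (induction rule: converse_rtranclp_induct)
  case base
  show ?case by (rule assms(3))
next
  case (step z z')
  from step.hyps(1) obtain u a v where "z = u @ [a, a] @ v" "z' = u @ v"
    by cases
  then show ?case
    using step.IH step.prems pair_matched_delete[of u a v] assms(4) by metis
qed

text \<open>Letters are specialised to pairs with a color because \<open>delete_double\<close> acts
  on such words.\<close>

locale colored_links = symmetric_links V G
  for V :: "'v set" and G :: "'l \<times> color \<Rightarrow> 'v \<Rightarrow> 'v \<Rightarrow> 'b"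
begin

lemma card_closed_walks_ge:
  assumes "delete_double\<^sup>*\<^sup>* z []" and "pair_matched z"
  shows "card V ^ Suc (card (set z)) \<le> card (closed_walks z)"
  using assms
proof (induction rule: reducible_pair_matched_induct)
  case Nil
  show ?case by (simp add: card_closed_walks_Nil)
next
  case (insert u v a)
  then have "card V ^ Suc (card (set (u @ [a, a] @ v))) = card V ^ Suc (card (set (u @ v))) * card V"
    by simp
  also have "\<dots> \<le> card (closed_walks (u @ v)) * card V"
    using insert.IH by (rule mult_right_mono) simp
  also have "\<dots> \<le> card (closed_walks (u @ [a, a] @ v))"
    using insert.hyps(2,3) by (rule card_closed_walks_insert_ge)
  finally show ?case .
qed

text \<open>Each insertion multiplies the previous bound by \<open>card V\<close> and adds open
  walks of one order below the new leading term. The factor \<open>length z\<close> generously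
  counts these contributions.\<close>

lemma card_closed_walks_le:
  assumes "delete_double\<^sup>*\<^sup>* z []" and "pair_matched z"
    and B: "\<And>s x t. x \<in> V \<Longrightarrow> card {y \<in> V. G s x y = t} \<le> B" and "1 \<le> B"
    and C: "\<And>s x y. x \<in> V \<Longrightarrow> y \<in> V \<Longrightarrow> x \<noteq> y \<Longrightarrow> card {j \<in> V. G s j x = G s j y} \<le> C"
  shows "card (closed_walks z) \<le>
    card V ^ Suc (card (set z)) + length z * C * B ^ length z * card V ^ card (set z)"
  using assms(1,2)
proof (induction rule: reducible_pair_matched_induct)
  case Nil
  show ?case by (simp add: card_closed_walks_Nil)
next
  case (insert u v a)
  define n m l where "n = card V" and "m = card (set (u @ v))" and "l = length (u @ v)"
  have walks: "card (walks (v @ u)) \<le> n ^ Suc m * B ^ l"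
    using card_walks_le[OF B \<open>1 \<le> B\<close>, of "v @ u"]
    by (simp add: n_def m_def l_def Un_commute add.commute)
  have "card (closed_walks (u @ [a, a] @ v)) \<le>
      card (closed_walks (u @ v)) * n + card (walks (v @ u)) * C"
    unfolding n_def by (rule card_closed_walks_insert_le[OF C])
  also have "\<dots> \<le> (n ^ Suc m + l * C * B ^ l * n ^ m) * n + n ^ Suc m * B ^ l * C"
    using insert.IH walks unfolding n_def m_def l_def by (intro add_mono mult_right_mono) auto
  also have "\<dots> = n ^ Suc (Suc m) + (l + 1) * C * B ^ l * n ^ Suc m"
    by (simp add: algebra_simps)
  \<comment> \<open>The error is loosened to match the length \<open>l + 2\<close> of the longer
    word.\<close>
  also have "\<dots> \<le> n ^ Suc (Suc m) + (l + 2) * C * B ^ (l + 2) * n ^ Suc m"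
    using \<open>1 \<le> B\<close> by (intro add_left_mono mult_right_mono mult_mono power_increasing) auto
  finally show ?case
    using insert.hyps(2,3) by (simp add: n_def m_def l_def)
qed

end

section \<open>From circuits to closed walks\<close>

lemma count_list_conv_filter: "count_list xs a = length (filter ((=) a) xs)"
  by (induction xs) auto

text \<open>In a word of \<open>CW2\<close> a letter determines its color, so attaching colors does
  not change the multiplicities.\<close>

lemma pair_matched_zip:
  assumes "w \<in> CW2 cs"
  shows "pair_matched (zip w cs)"
  unfolding pair_matched_def
proof
  have len: "length w = length cs"
    and same_color: "\<And>i j. i < length w \<Longrightarrow> j < length w \<Longrightarrow> w ! i = w ! j \<Longrightarrow> cs ! i = cs ! j"
    using assms unfolding CW2_def by blast+
  fix s assume s: "s \<in> set (zip w cs)"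
  have "(fst s = fst t) = (s = t)" if "t \<in> set (zip w cs)" for t
    using s that same_color len by (metis fst_conv in_set_zip prod_eqI)
  then have "filter ((=) s) (zip w cs) = filter (\<lambda>t. fst s = fst t) (zip w cs)"
    by (intro filter_cong) auto
  moreover have "count_list w (fst s) = count_list (map fst (zip w cs)) (fst s)"
    using len by simp
  then have "count_list w (fst s) = length (filter (\<lambda>t. fst s = fst t) (zip w cs))"
    by (simp only: count_list_conv_filter filter_map length_map comp_def)
  moreover have "fst s \<in> set w"
    using s by (metis in_set_zipE prod.collapse)
  ultimately show "count_list (zip w cs) s = 2"
    using assms by (simp add: CW2_def count_list_conv_filter)
qed

abbreviation letter_link ::
  "'d1::finite link \<Rightarrow> 'd2::finite link \<Rightarrow> nat \<Rightarrow> 'l \<times> color \<Rightarrow> nat \<Rightarrow> nat \<Rightarrow> int ^ 'd1 + int ^ 'd2"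
  where "letter_link L1 L2 n s \<equiv> color_link L1 L2 (snd s) n"

lemma colored_links_letter_link:
  assumes "link_function L1" and "link_function L2"
  shows "colored_links {1..n} (letter_link L1 L2 n)"
proof unfold_locales
  fix s :: "'l \<times> color" and x y
  assume "x \<in> {1..n}" "y \<in> {1..n}"
  then show "letter_link L1 L2 n s x y = letter_link L1 L2 n s y x"
    using assms by (cases "snd s") (auto simp: link_function_def color_link_def)
qed simp

lemma property_B_color_link:
  assumes "property_B L1" and "property_B L2"
  shows "\<exists>B\<ge>1. \<forall>c n t. \<forall>k\<in>{1..n}. card {l \<in> {1..n}. color_link L1 L2 c n k l = t} \<le> B"
proof -
  obtain B1 B2 where
    B1: "\<And>n t k. k \<in> {1..n} \<Longrightarrow> card {l \<in> {1..n}. L1 n k l = t} \<le> B1" and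
    B2: "\<And>n t k. k \<in> {1..n} \<Longrightarrow> card {l \<in> {1..n}. L2 n k l = t} \<le> B2"
    using assms unfolding property_B_def by blast
  \<comment> \<open>The \<open>1\<close> in the maximum secures \<open>1 \<le> B\<close>. If
    \<open>t\<close> lies in the summand of the other color, the set is empty.\<close>
  have "card {l \<in> {1..n}. color_link L1 L2 c n k l = t} \<le> max 1 (max B1 B2)"
    if "k \<in> {1..n}" for c n k t
    using B1[OF that] B2[OF that]
    by (cases c; cases t) (auto simp: color_link_def le_max_iff_disj)
  then show ?thesis
    by (intro exI[of _ "max 1 (max B1 B2)"]) auto
qed

lemma property_P_color_link:
  assumes "property_P L1" and "property_P L2"
  shows "\<exists>C. \<forall>c n. \<forall>i\<in>{1..n}. \<forall>j\<in>{1..n}. i \<noteq> j \<longrightarrow>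
    card {k \<in> {1..n}. color_link L1 L2 c n k i = color_link L1 L2 c n k j} \<le> C"
proof -
  obtain C1 where C1: "\<forall>n. \<forall>i\<in>{1..n}. \<forall>j\<in>{1..n}. i \<noteq> j \<longrightarrow> card {k \<in> {1..n}. L1 n k i = L1 n k j} \<le> C1"
    using assms(1) unfolding property_P_def ..
  obtain C2 where C2: "\<forall>n. \<forall>i\<in>{1..n}. \<forall>j\<in>{1..n}. i \<noteq> j \<longrightarrow> card {k \<in> {1..n}. L2 n k i = L2 n k j} \<le> C2"
    using assms(2) unfolding property_P_def ..
  have "card {k \<in> {1..n}. color_link L1 L2 c n k i = color_link L1 L2 c n k j} \<le> max C1 C2"
    if "i \<in> {1..n}" "j \<in> {1..n}" "i \<noteq> j" for c n i j
    using C1[rule_format, OF that] C2[rule_format, OF that]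
    by (cases c) (auto simp: color_link_def le_max_iff_disj)
  then show ?thesis
    by blast
qed

text \<open>A circuit corresponds to the list of its values at \<open>0, ..., 2 * k\<close>.\<close>

lemma card_Pi_C:
  fixes w :: "'l list"
  assumes "link_function L1" and "link_function L2" and "w \<in> CW2 cs" and "length cs = 2 * k"
  shows "card (Pi_C L1 L2 cs k w n) =
    card (symmetric_links.closed_walks {1..n} (letter_link L1 L2 n) (zip w cs))"
proof -
  interpret colored_links "{1..n}" "letter_link L1 L2 n :: 'l \<times> color \<Rightarrow> _"
    using assms(1,2) by (rule colored_links_letter_link)
  let ?z = "zip w cs" and ?f = "\<lambda>\<pi>::nat \<Rightarrow> nat. map \<pi> [0..<Suc (2 * k)]"
  have lw: "length w = 2 * k"
    and same_color: "\<And>i j. i < 2 * k \<Longrightarrow> j < 2 * k \<Longrightarrow> w ! i = w ! j \<Longrightarrow> cs ! i = cs ! j"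
    using assms(3,4) unfolding CW2_def mem_Collect_eq by metis+
  have lz: "length ?z = 2 * k"
    using lw assms(4) by simp
  \<comment> \<open>This is the constraint with positions counted from 0; \<open>same_color\<close>
    supplies the color clause of \<open>Pi_C\<close>.\<close>
  define good where "good \<pi> \<longleftrightarrow> (\<forall>i<2*k. \<forall>j<2*k. w ! i = w ! j \<longrightarrow>
    color_link L1 L2 (cs ! i) n (\<pi> i) (\<pi> (Suc i)) = color_link L1 L2 (cs ! j) n (\<pi> j) (\<pi> (Suc j)))" for \<pi>
  have shift: "(\<forall>i\<in>{1..2*k}. P i) \<longleftrightarrow> (\<forall>i<2*k. P (Suc i))" for P
    unfolding image_Suc_lessThan[symmetric] by auto
  have Pi: "\<pi> \<in> Pi_C L1 L2 cs k w n \<longleftrightarrow> \<pi> \<in> circuits k n \<and> good \<pi>" for \<pi>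
    unfolding Pi_C_def good_def shift mem_Collect_eq diff_Suc_1 using same_color by blast
  have con: "consistent (steps ?z p) \<longleftrightarrow> good ((!) p)" if "length p = Suc (2 * k)" for p
  proof -
    have "steps ?z p = {((w ! i, cs ! i), p ! i, p ! Suc i) |i. i < 2 * k}"
      unfolding steps_conv_nth[OF that[folded lz]] lz
      using lw assms(4) by (intro Collect_cong ex_cong1) auto
    moreover have "(w ! i, cs ! i) = (w ! j, cs ! j) \<longleftrightarrow> w ! i = w ! j" if "i < 2 * k" "j < 2 * k" for i j
      using same_color[OF that] by blast
    ultimately show ?thesis
      by (simp only: consistent_Collect good_def snd_conv cong: imp_cong)
  qed
  have closed: "p \<in> closed_walks ?z \<longleftrightarrow>
      length p = Suc (2 * k) \<and> set p \<subseteq> {1..n} \<and> good ((!) p) \<and> hd p = last p" for p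
    unfolding closed_walks_def walks_def mem_Collect_eq lz using con by blast
  have good_cong: "good \<pi> \<longleftrightarrow> good \<pi>'" if "\<And>i. i \<le> 2 * k \<Longrightarrow> \<pi> i = \<pi>' i" for \<pi> \<pi>'
    using that by (simp add: good_def)
  have "bij_betw ?f (Pi_C L1 L2 cs k w n) (closed_walks ?z)"
  \<comment> \<open>Circuits are extensional functions, so the inverse must restrict list access to
    \<open>{0..2*k}\<close>.\<close>
  proof (rule bij_betw_byWitness[where f' = "\<lambda>p. restrict ((!) p) {0..2*k}"])
    show "\<forall>\<pi>\<in>Pi_C L1 L2 cs k w n. restrict ((!) (?f \<pi>)) {0..2*k} = \<pi>"
    proof (intro ballI ext)
      fix \<pi> i assume "\<pi> \<in> Pi_C L1 L2 cs k w n"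
      then show "restrict ((!) (?f \<pi>)) {0..2*k} i = \<pi> i"
        by (cases "i \<le> 2 * k") (auto simp: Pi circuits_def PiE_def extensional_def simp del: upt_Suc)
    qed
    show "\<forall>p\<in>closed_walks ?z. ?f (restrict ((!) p) {0..2*k}) = p"
    proof
      fix p assume "p \<in> closed_walks ?z"
      then show "?f (restrict ((!) p) {0..2*k}) = p"
        unfolding closed by (auto simp: list_eq_iff_nth_eq simp del: upt_Suc)
    qed
    show "?f ` Pi_C L1 L2 cs k w n \<subseteq> closed_walks ?z"
    proof (rule image_subsetI)
      fix \<pi> assume \<pi>: "\<pi> \<in> Pi_C L1 L2 cs k w n"
      then have "good ((!) (?f \<pi>))"
        unfolding Pi using good_cong[of \<pi> "(!) (?f \<pi>)"] by (simp del: upt_Suc)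
      moreover have "set (?f \<pi>) \<subseteq> {1..n}" and "\<pi> 0 = \<pi> (2 * k)"
        using \<pi> unfolding Pi circuits_def by (auto simp del: upt_Suc)
      ultimately show "?f \<pi> \<in> closed_walks ?z"
        unfolding closed by (simp add: hd_map last_map del: upt_Suc)
    qed
    show "(\<lambda>p. restrict ((!) p) {0..2*k}) ` closed_walks ?z \<subseteq> Pi_C L1 L2 cs k w n"
    proof (rule image_subsetI)
      fix p assume p: "p \<in> closed_walks ?z"
      then have len: "length p = Suc (2 * k)" and V: "set p \<subseteq> {1..n}" and cl: "hd p = last p"
        unfolding closed by auto
      have "good (restrict ((!) p) {0..2*k})"
        using p good_cong[of "(!) p" "restrict ((!) p) {0..2*k}"] unfolding closed by simp
      moreover have "p ! i \<in> {1..n}" if "i \<le> 2 * k" for i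
        using len that by (intro subsetD[OF V] nth_mem) simp
      moreover have "p ! 0 = p ! (2 * k)"
        using cl len by (metis diff_Suc_1 hd_conv_nth last_conv_nth list.size(3) nat.distinct(1))
      ultimately show "restrict ((!) p) {0..2*k} \<in> Pi_C L1 L2 cs k w n"
        unfolding Pi circuits_def by auto
    qed
  qed
  then show ?thesis
    by (rule bij_betw_same_card)
qed

section \<open>The normalised count and its limit\<close>

theorem theorem3p3:
  fixes M :: "'a measure"
    and L1 :: "'d1::finite link" and L2 :: "'d2::finite link"
    and x :: "int ^ 'd1 \<Rightarrow> 'a \<Rightarrow> real" and y :: "int ^ 'd2 \<Rightarrow> 'a \<Rightarrow> real"
    and X Y :: "nat \<Rightarrow> nat \<Rightarrow> nat \<Rightarrow> 'a \<Rightarrow> real"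
    and cs :: "color list" and k :: nat and w :: "'l list"
  assumes "prob_space M"
    and "patterned_matrix L1 x X" and "patterned_matrix L2 y Y"
    and "property_B L1" and "property_B L2"
    and "prob_space.standard_inputs M (case_sum x y)"
    and "length cs = 2 * k"
    and "colored_catalan cs w"
  shows "((\<forall>n. card (Pi_C L1 L2 cs k w n) \<ge> n ^ (1 + k)) \<and>
          (convergent (p_C_seq L1 L2 cs k w) \<longrightarrow> p_C L1 L2 cs k w \<ge> 1)) \<and>
         (property_P L1 \<and> property_P L2 \<longrightarrow>
            convergent (p_C_seq L1 L2 cs k w) \<and> p_C L1 L2 cs k w = 1)"
proof -
  have L: "link_function L1" "link_function L2" and w: "w \<in> CW2 cs"
    and red: "delete_double\<^sup>*\<^sup>* (zip w cs) []"
    using assms(2,3,8) by (auto simp: patterned_matrix_def colored_catalan_def)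
  have pm: "pair_matched (zip w cs)"
    using w by (rule pair_matched_zip)
  have len: "length (zip w cs) = 2 * k"
    using w assms(7) by (simp add: CW2_def)
  then have card_set: "card (set (zip w cs)) = k"
    using length_pair_matched[OF pm] by simp
  note card_Pi = card_Pi_C[OF L w assms(7)]
  note links = colored_links_letter_link[OF L]
  have ge: "n ^ (1 + k) \<le> card (Pi_C L1 L2 cs k w n)" for n
    using colored_links.card_closed_walks_ge[OF links red pm, of n]
    by (simp add: card_Pi card_set)
  then have "real n ^ (1 + k) \<le> real (card (Pi_C L1 L2 cs k w n))" for n
    by (metis of_nat_le_iff of_nat_power)
  \<comment> \<open>At \<open>n = 0\<close> the quotient is 0 by the convention for division by
    zero, hence \<open>1 \<le> n\<close>.\<close>
  then have seq_ge: "1 \<le> p_C_seq L1 L2 cs k w n" if "1 \<le> n" for n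
    using that by (simp add: p_C_seq_def)
  have "1 \<le> p_C L1 L2 cs k w" if "convergent (p_C_seq L1 L2 cs k w)"
    using that seq_ge unfolding p_C_def convergent_LIMSEQ_iff by (intro LIMSEQ_le_const) auto
  moreover have "p_C_seq L1 L2 cs k w \<longlonglongrightarrow> 1" if P: "property_P L1" "property_P L2"
  proof -
    obtain B where "1 \<le> B" and
      B: "\<forall>c n t. \<forall>k\<in>{1..n}. card {l \<in> {1..n}. color_link L1 L2 c n k l = t} \<le> B"
      using property_B_color_link[OF assms(4,5)] by blast
    obtain C where C: "\<forall>c n. \<forall>i\<in>{1..n}. \<forall>j\<in>{1..n}. i \<noteq> j \<longrightarrow>
        card {k \<in> {1..n}. color_link L1 L2 c n k i = color_link L1 L2 c n k j} \<le> C"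
      using property_P_color_link[OF P] by blast
    \<comment> \<open>\<open>D\<close> is the coefficient of the error term for a word of length
      \<open>2 * k\<close> with \<open>k\<close> letters; after normalisation the error is
      \<open>D / n\<close>.\<close>
    define D where "D = 2 * k * C * B ^ (2 * k)"
    have le: "card (Pi_C L1 L2 cs k w n) \<le> n ^ (1 + k) + D * n ^ k" for n
      using colored_links.card_closed_walks_le
        [OF links red pm B[rule_format] \<open>1 \<le> B\<close> C[rule_format], of n]
      unfolding card_Pi card_set len D_def by simp
    have seq_le: "p_C_seq L1 L2 cs k w n \<le> 1 + real D / real n" if "1 \<le> n" for n
    proof -
      have "real (card (Pi_C L1 L2 cs k w n)) \<le> real n ^ (1 + k) + real D * real n ^ k"
        using le[of n] by (metis of_nat_le_iff of_nat_add of_nat_mult of_nat_power)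
      then show ?thesis
        using that by (simp add: p_C_seq_def field_simps)
    qed
    have "\<forall>\<^sub>F n in sequentially. 1 \<le> p_C_seq L1 L2 cs k w n"
      using seq_ge by (rule eventually_sequentiallyI)
    moreover have "\<forall>\<^sub>F n in sequentially. p_C_seq L1 L2 cs k w n \<le> 1 + real D / real n"
      using seq_le by (rule eventually_sequentiallyI)
    moreover have "(\<lambda>n. 1 + real D / real n) \<longlonglongrightarrow> 1"
      using tendsto_add[OF tendsto_const lim_const_over_n[of "real D"], of 1] by simp
    ultimately show ?thesis
      by (rule tendsto_sandwich[OF _ _ tendsto_const])
  qed
  ultimately show ?thesis
    using ge unfolding p_C_def by (auto intro: convergentI limI)
qed

end
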